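(* Two split quaternions $a,b\in\mathbb{H}_s\setminus\mathbb{R}$ are consimilar if and only if one of the following two conditions holds: (1) $\overline{a}+b=0$; (2) $I_a=I_b$ and $I_{\overline{a}+b}\neq0$.
   Context: $\mathbb{H}_s=\{q_0+q_1\mathbf{i}+q_2\mathbf{j}+q_3\mathbf{k}: q_i\in\mathbb{R}\}$ is the real associative algebra of split quaternions with $\mathbf{i}^2=-1$, $\mathbf{j}^2=\mathbf{k}^2=1$, $\mathbf{i}\mathbf{j}=\mathbf{k}=-\mathbf{j}\mathbf{i}$, $\mathbf{j}\mathbf{k}=-\mathbf{i}=-\mathbf{k}\mathbf{j}$, $\mathbf{k}\mathbf{i}=\mathbf{j}=-\mathbf{i}\mathbf{k}$. For $q=q_0+q_1\mathbf{i}+q_2\mathbf{j}+q_3\mathbf{k}$: $\overline{q}=q_0-q_1\mathbf{i}-q_2\mathbf{j}-q_3\mathbf{k}$, $I_q=q\overline{q}=q_0^2+q_1^2-q_2^2-q_3^2$, and $Z(\mathbb{H}_s)=\{q\in\mathbb{H}_s:I_q=0\}$. Two split quaternions $a,b$ are consimilar if there exists $q\in\mathbb{H}_s\setminus Z(\mathbb{H}_s)$ such that $aq=\overline{q}\,b$. *)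

theory Defs
  imports Complex_Main
begin

(* SQuat q0 q1 q2 q3 stands for q0 + q1 i + q2 j + q3 k. *)
datatype squat = SQuat (sq0: real) (sq1: real) (sq2: real) (sq3: real)

lemma squat_eq_iff:
  "p = q \<longleftrightarrow> sq0 p = sq0 q \<and> sq1 p = sq1 q \<and> sq2 p = sq2 q \<and> sq3 p = sq3 q"
  by (cases p; cases q) auto

(* The product is the bilinear extension of
   i^2 = -1, j^2 = k^2 = 1, ij = k = -ji, jk = -i = -kj, ki = j = -ik;
   these relations are checked in squat_unit_relations below. *)
instantiation squat :: real_algebra_1
begin

definition "0 = SQuat 0 0 0 0"

definition "1 = SQuat 1 0 0 0"

definition "p + q = SQuat (sq0 p + sq0 q) (sq1 p + sq1 q) (sq2 p + sq2 q) (sq3 p + sq3 q)"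

definition "- q = SQuat (- sq0 q) (- sq1 q) (- sq2 q) (- sq3 q)"

definition "p - q = SQuat (sq0 p - sq0 q) (sq1 p - sq1 q) (sq2 p - sq2 q) (sq3 p - sq3 q)"

definition "p * q = SQuat
  (sq0 p * sq0 q - sq1 p * sq1 q + sq2 p * sq2 q + sq3 p * sq3 q)
  (sq0 p * sq1 q + sq1 p * sq0 q - sq2 p * sq3 q + sq3 p * sq2 q)
  (sq0 p * sq2 q + sq2 p * sq0 q - sq1 p * sq3 q + sq3 p * sq1 q)
  (sq0 p * sq3 q + sq3 p * sq0 q + sq1 p * sq2 q - sq2 p * sq1 q)"

definition "r *\<^sub>R q = SQuat (r * sq0 q) (r * sq1 q) (r * sq2 q) (r * sq3 q)"

instance
  by intro_classes
    (simp_all add: squat_eq_iff zero_squat_def one_squat_def plus_squat_def uminus_squat_def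
      minus_squat_def times_squat_def scaleR_squat_def algebra_simps)

end

definition sq_i :: squat where "sq_i = SQuat 0 1 0 0"
definition sq_j :: squat where "sq_j = SQuat 0 0 1 0"
definition sq_k :: squat where "sq_k = SQuat 0 0 0 1"

lemma squat_unit_relations:
  "sq_i * sq_i = -1" "sq_j * sq_j = 1" "sq_k * sq_k = 1"
  "sq_i * sq_j = sq_k" "sq_j * sq_i = - sq_k"
  "sq_j * sq_k = - sq_i" "sq_k * sq_j = sq_i"
  "sq_k * sq_i = sq_j" "sq_i * sq_k = - sq_j"
  by (simp_all add: sq_i_def sq_j_def sq_k_def one_squat_def uminus_squat_def times_squat_def)

lemma of_real_squat: "of_real r = SQuat r 0 0 0"
  by (simp add: of_real_def one_squat_def scaleR_squat_def)

lemma squat_basis_expansion: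
  "SQuat q0 q1 q2 q3 = of_real q0 + of_real q1 * sq_i + of_real q2 * sq_j + of_real q3 * sq_k"
  by (simp add: of_real_squat sq_i_def sq_j_def sq_k_def plus_squat_def times_squat_def)

definition sq_conj :: "squat \<Rightarrow> squat" where
  "sq_conj q = SQuat (sq0 q) (- sq1 q) (- sq2 q) (- sq3 q)"

definition sq_I :: "squat \<Rightarrow> real" where
  "sq_I q = (sq0 q)\<^sup>2 + (sq1 q)\<^sup>2 - (sq2 q)\<^sup>2 - (sq3 q)\<^sup>2"

lemma of_real_sq_I: "of_real (sq_I q) = q * sq_conj q"
  by (simp add: of_real_squat sq_I_def sq_conj_def times_squat_def power2_eq_square)

definition sq_Z :: "squat set" where
  "sq_Z = {q. sq_I q = 0}"

definition consimilar :: "squat \<Rightarrow> squat \<Rightarrow> bool" where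
  "consimilar a b \<longleftrightarrow> (\<exists>q. q \<notin> sq_Z \<and> a * q = sq_conj q * b)"

end

theory Submission
  imports Defs
begin

text \<open>Everything rests on the element \<open>s = sq_conj a + b\<close>.  If the norms of \<open>a\<close> and \<open>b\<close> agree,
  then \<open>a s = n + a b = sq_conj s * b\<close>, where \<open>n\<close> is the common norm, so \<open>s\<close> witnesses
  consimilarity as soon as it is invertible.  Conversely, \<^emph>\<open>every\<close> \<open>q\<close> with
  \<open>a q = sq_conj q * b\<close> satisfies \<open>sq_I q \<cdot> s = t \<cdot> q\<close> for some real \<open>t\<close>: up to a scalar,
  \<open>s\<close> is either the given witness or zero.  Hence \<open>s\<close> cannot be a nonzero null element
  when a witness of nonzero norm exists.  Equality of the norms follows from their
  multiplicativity.

  There remains \<open>s = 0\<close>, that is \<open>b = - sq_conj a\<close>.  The equation then says that \<open>a q\<close> has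
  real part zero.  This is one linear condition on \<open>q\<close>, and the norm, a form of signature
  (2,2), cannot vanish identically on its at least three-dimensional solution space.\<close>

lemmas squat_components =
  squat_eq_iff plus_squat_def times_squat_def sq_conj_def

lemma sq_conj_mult: "sq_conj (p * q) = sq_conj q * sq_conj p"
  by (simp add: squat_components algebra_simps)

lemma sq_conj_add: "sq_conj (p + q) = sq_conj p + sq_conj q"
  by (simp add: squat_components)

lemma sq_conj_conj [simp]: "sq_conj (sq_conj q) = q"
  by (simp add: squat_components)

lemma sq_I_conj [simp]: "sq_I (sq_conj q) = sq_I q"
  by (simp add: sq_I_def sq_conj_def)

lemma mult_sq_conj: "q * sq_conj q = of_real (sq_I q)"
  by (simp add: of_real_sq_I)

lemma sq_conj_mult_self: "sq_conj q * q = of_real (sq_I q)"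
  using mult_sq_conj[of "sq_conj q"] by simp

lemma sq_I_mult: "sq_I (p * q) = sq_I p * sq_I q"
  by (simp add: sq_I_def times_squat_def power2_eq_square algebra_simps)

lemma sq_I_scaleR: "sq_I (r *\<^sub>R q) = r\<^sup>2 * sq_I q"
  by (simp add: sq_I_def scaleR_squat_def power_mult_distrib algebra_simps)

lemma add_sq_conj: "q + sq_conj q = of_real (2 * sq0 q)"
  by (simp add: squat_components of_real_squat)

text \<open>Norms are multiplicative and \<open>q\<close> and \<open>sq_conj q\<close> have the same nonzero norm, which cancels.\<close>

lemma consimilar_imp_sq_I_eq:
  assumes "consimilar a b"
  shows "sq_I a = sq_I b"
proof -
  obtain q where q: "sq_I q \<noteq> 0" and eq: "a * q = sq_conj q * b"
    using assms by (auto simp: consimilar_def sq_Z_def)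
  have "sq_I a * sq_I q = sq_I q * sq_I b"
    using arg_cong[OF eq, of sq_I] by (simp add: sq_I_mult)
  then show ?thesis
    using q by simp
qed

text \<open>Conjugating the equation and multiplying by \<open>q\<close> on the left gives
  \<open>sq_I q \<cdot> sq_conj a = q * sq_conj b * q\<close>, while trivially
  \<open>sq_I q \<cdot> b = b * sq_conj q * q\<close>.  In the sum, the left factor of \<open>q\<close> is an element plus
  its own conjugate, hence real.\<close>

lemma conj_plus_parallel_to_intertwiner:
  assumes eq: "a * q = sq_conj q * b"
  shows "sq_I q *\<^sub>R (sq_conj a + b) = (2 * sq0 (b * sq_conj q)) *\<^sub>R q"
proof -
  have conj_eq: "sq_conj q * sq_conj a = sq_conj b * q"
    using arg_cong[OF eq, of sq_conj] by (simp add: sq_conj_mult)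
  have "sq_I q *\<^sub>R sq_conj a = q * (sq_conj q * sq_conj a)"
    by (simp add: mult.assoc[symmetric] mult_sq_conj scaleR_conv_of_real)
  also have "\<dots> = sq_conj (b * sq_conj q) * q"
    by (simp add: conj_eq sq_conj_mult mult.assoc)
  finally have 1: "sq_I q *\<^sub>R sq_conj a = sq_conj (b * sq_conj q) * q" .
  have 2: "sq_I q *\<^sub>R b = (b * sq_conj q) * q"
    by (simp add: mult.assoc sq_conj_mult_self of_real_def)
  have "sq_I q *\<^sub>R (sq_conj a + b) = (b * sq_conj q + sq_conj (b * sq_conj q)) * q"
    by (simp add: scaleR_add_right 1 2 distrib_right add.commute)
  then show ?thesis
    by (simp only: add_sq_conj scaleR_conv_of_real)
qed

text \<open>A nonzero multiple of an element of nonzero norm has nonzero norm.\<close>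

lemma consimilar_imp_conj_plus_zero_or_regular:
  assumes "consimilar a b"
  shows "sq_conj a + b = 0 \<or> sq_I (sq_conj a + b) \<noteq> 0"
proof -
  obtain q where q: "sq_I q \<noteq> 0" and eq: "a * q = sq_conj q * b"
    using assms by (auto simp: consimilar_def sq_Z_def)
  define t where "t = 2 * sq0 (b * sq_conj q)"
  have par: "sq_I q *\<^sub>R (sq_conj a + b) = t *\<^sub>R q"
    unfolding t_def by (rule conj_plus_parallel_to_intertwiner[OF eq])
  show ?thesis
  proof (cases "t = 0")
    case True
    then show ?thesis
      using par q by simp
  next
    case False
    have "(sq_I q)\<^sup>2 * sq_I (sq_conj a + b) = t\<^sup>2 * sq_I q"
      using arg_cong[OF par, of sq_I] by (simp only: sq_I_scaleR)
    then show ?thesis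
      using False q by auto
  qed
qed

lemma conj_plus_intertwines:
  assumes "sq_I a = sq_I b"
  shows "a * (sq_conj a + b) = sq_conj (sq_conj a + b) * b"
  by (simp add: assms sq_conj_add distrib_left distrib_right mult_sq_conj
      sq_conj_mult_self add.commute)

lemma consimilar_neg_conj: "consimilar a (- sq_conj a)"
proof -
  \<comment> \<open>In coordinates the real part of \<open>a * q\<close> is \<open>a0 q0 - a1 q1 + a2 q2 + a3 q3\<close>.  It vanishes
    at \<open>q = a1 + a0 i\<close>, whose norm is \<open>a0\<^sup>2 + a1\<^sup>2\<close>, and at \<open>q = 1\<close> if that norm is zero.\<close>
  define q where
    "q = (if sq0 a = 0 \<and> sq1 a = 0 then SQuat 1 0 0 0 else SQuat (sq1 a) (sq0 a) 0 0)"
  have "sq0 (a * q) = 0"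
    by (simp add: q_def times_squat_def)
  then have "a * q = - sq_conj (a * q)"
    using add_sq_conj[of "a * q"] by (simp add: eq_neg_iff_add_eq_0)
  then have "a * q = sq_conj q * (- sq_conj a)"
    by (simp add: sq_conj_mult)
  moreover have "sq_I q \<noteq> 0"
    by (auto simp: q_def sq_I_def sum_power2_eq_zero_iff)
  ultimately show ?thesis
    by (auto simp: consimilar_def sq_Z_def)
qed

theorem theorem4p4:
  fixes a b :: squat
  assumes "a \<notin> \<real>" and "b \<notin> \<real>"
  shows "consimilar a b \<longleftrightarrow>
    sq_conj a + b = 0 \<or> (sq_I a = sq_I b \<and> sq_I (sq_conj a + b) \<noteq> 0)"
proof
  assume "consimilar a b"
  then show "sq_conj a + b = 0 \<or> (sq_I a = sq_I b \<and> sq_I (sq_conj a + b) \<noteq> 0)"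
    using consimilar_imp_sq_I_eq consimilar_imp_conj_plus_zero_or_regular by blast
next
  assume "sq_conj a + b = 0 \<or> (sq_I a = sq_I b \<and> sq_I (sq_conj a + b) \<noteq> 0)"
  then show "consimilar a b"
  proof
    assume "sq_conj a + b = 0"
    then have "b = - sq_conj a"
      by (simp add: eq_neg_iff_add_eq_0 add.commute)
    then show ?thesis
      by (simp add: consimilar_neg_conj)
  next
    assume "sq_I a = sq_I b \<and> sq_I (sq_conj a + b) \<noteq> 0"
    then show ?thesis
      unfolding consimilar_def sq_Z_def using conj_plus_intertwines by blast
  qed
qed

end
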